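(* Let $p$ be a prime and let $A=(a_1,\dots,a_\ell)$ be a sequence of $\ell > p$ nonzero elements of $\mathbb{F}_p$. Then $\dim(A)=\ell-1$.
   Context: For a sequence $A=(a_1,\dots,a_\ell)$ of nonzero elements of $\mathbb{F}_p$, let $\mathcal{S}_A=\{x\in\{0,1\}^\ell : a_1x_1+\dots+a_\ell x_\ell=0 \text{ in } \mathbb{F}_p\}$ be the set of $0$-$1$ solutions of the equation $a_1x_1+\dots+a_\ell x_\ell=0$, viewed as vectors of $\mathbb{F}_p^\ell$, and let $\dim(A)$ denote the dimension of the $\mathbb{F}_p$-linear span $\langle\mathcal{S}_A\rangle\subseteq\mathbb{F}_p^\ell$. *)

theory Defs
  imports "HOL-Analysis.Analysis" "Berlekamp_Zassenhaus.Finite_Field"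
begin

text \<open>
  A sequence of length \<open>l\<close> over a field is a vector of type \<open>'a ^ 'l\<close> with \<open>CARD('l) = l\<close>.
  Linear notions are those of the vector space \<open>'a ^ 'l\<close> over \<open>'a\<close> (\<open>vec.span\<close>
  and \<open>vec.dim\<close>, with scalar multiplication \<open>*s\<close>), not the real ones.
\<close>

definition zero_one_solutions :: "'a::field ^ 'l::finite \<Rightarrow> ('a ^ 'l) set"
  where "zero_one_solutions A =
    {x. (\<forall>i. x $ i \<in> {0, 1}) \<and> (\<Sum>i\<in>UNIV. A $ i * x $ i) = 0}"

definition solution_dim :: "'a::field ^ 'l::finite \<Rightarrow> nat"
  where "solution_dim A = vec.dim (vec.span (zero_one_solutions A))"

end

theory Submission
  imports Defs
begin

text \<open>
  A vector \<open>b\<close> orthogonal to every \<open>0\<close>-\<open>1\<close> solution makes the polynomial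
  \<open>(1 - (\<Sum>i. A i * x i) ^ (p - 1)) * (\<Sum>i. b i * x i)\<close> of degree \<open>p\<close> vanish on the whole cube
  \<open>{0, 1}\<^sup>l\<close>. Hence, for every set \<open>I\<close> of \<open>p\<close> indices, the coefficient of \<open>\<Prod>i\<in>I. x i\<close> in its
  multilinear reduction is zero, that is, \<open>(p - 1)! * (\<Sum>i\<in>I. b i * (\<Prod>j\<in>I - {i}. A j)) = 0\<close>.
  So the ratios \<open>b i / A i\<close> sum to zero over every \<open>p\<close>-set of indices; as \<open>l > p\<close>, exchanging
  one index for another shows that they are all equal. Thus the orthogonal complement of the
  solution set is the line spanned by \<open>A\<close>.
\<close>

text \<open>
  For \<open>f\<close> defined on the cube (with its points read as sets), this is the coefficient
  of \<open>\<Prod>i\<in>I. x i\<close> in the multilinear polynomial that represents \<open>f\<close>.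
\<close>

definition alternating_sum :: "'i set \<Rightarrow> ('i set \<Rightarrow> 'a::comm_ring_1) \<Rightarrow> 'a"
  where "alternating_sum I f = (\<Sum>J\<in>Pow I. (-1) ^ card (I - J) * f J)"

section \<open>Alternating sums as iterated finite differences\<close>

lemma alternating_sum_cong:
  "(\<And>J. J \<subseteq> I \<Longrightarrow> f J = g J) \<Longrightarrow> alternating_sum I f = alternating_sum I g"
  unfolding alternating_sum_def by (intro sum.cong) auto

lemma alternating_sum_empty [simp]: "alternating_sum {} f = f {}"
  by (simp add: alternating_sum_def)

lemma alternating_sum_mult_left:
  "alternating_sum I (\<lambda>J. c * f J) = c * alternating_sum I f"
  by (simp add: alternating_sum_def sum_distrib_left mult_ac)

lemma alternating_sum_sum:
  "alternating_sum I (\<lambda>J. \<Sum>k\<in>K. f k J) = (\<Sum>k\<in>K. alternating_sum I (f k))"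
  unfolding alternating_sum_def sum_distrib_left by (rule sum.swap)

text \<open>Pairing \<open>J\<close> with \<open>insert i J\<close> flips the sign, so each index of
  the set acts as one finite difference operator. This drives inductions on
  \<open>I\<close>.\<close>

lemma alternating_sum_insert:
  assumes "finite I" "i \<notin> I"
  shows "alternating_sum (insert i I) f = alternating_sum I (\<lambda>J. f (insert i J) - f J)"
proof -
  let ?t = "\<lambda>J. (-1) ^ card (insert i I - J) * f J"
  have inj: "inj_on (insert i) (Pow I)"
    using assms by (intro inj_onI) (metis PowD insert_ident subsetD)
  have "alternating_sum (insert i I) f = sum ?t (Pow I) + sum ?t (insert i ` Pow I)"
    unfolding alternating_sum_def Pow_insert
    using assms by (intro sum.union_disjoint) auto
  also have "sum ?t (insert i ` Pow I) = (\<Sum>J\<in>Pow I. (-1) ^ card (I - J) * f (insert i J))"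
    unfolding sum.reindex[OF inj] o_def using assms
    by (intro sum.cong refl arg_cong2[of _ _ _ _ "(*)"] arg_cong[of _ _ "\<lambda>S. (-1) ^ card S"]) auto
  also have "sum ?t (Pow I) = (\<Sum>J\<in>Pow I. - ((-1) ^ card (I - J) * f J))"
  proof (intro sum.cong refl)
    fix J assume "J \<in> Pow I"
    then have "insert i I - J = insert i (I - J)" using assms by auto
    then show "?t J = - ((-1) ^ card (I - J) * f J)" using assms by simp
  qed
  finally show ?thesis
    by (simp add: alternating_sum_def algebra_simps sum_subtractf sum_negf)
qed

text \<open>Each difference lowers the degree by one, so \<open>card I\<close> of them kill all
  smaller powers and turn the power \<open>card I\<close> into a constant. The shift
  \<open>u\<close> makes room for \<open>a i\<close> once an index \<open>i\<close> has been split
  off.\<close>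

lemma alternating_sum_power:
  fixes a :: "'i \<Rightarrow> 'a::comm_ring_1"
  assumes "finite I" "n \<le> card I"
  shows "alternating_sum I (\<lambda>J. (u + sum a J) ^ n) = (if n = card I then of_nat (fact n) * prod a I else 0)"
  using assms
proof (induction I arbitrary: n u rule: finite_induct)
  case empty
  then show ?case by simp
next
  case (insert i I)
  define D where "D k = alternating_sum I (\<lambda>J. (u + sum a J) ^ k)" for k
  have D: "D k = (if k = card I then of_nat (fact k) * prod a I else 0)" if "k \<le> card I" for k
    using insert.IH[OF that] by (simp add: D_def)
  have "alternating_sum (insert i I) (\<lambda>J. (u + sum a J) ^ n)
      = alternating_sum I (\<lambda>J. (u + sum a (insert i J)) ^ n - (u + sum a J) ^ n)"
    using insert.hyps by (rule alternating_sum_insert)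
  also have "\<dots> = alternating_sum I (\<lambda>J. \<Sum>k<n. of_nat (n choose k) * a i ^ (n - k) * (u + sum a J) ^ k)"
  proof (rule alternating_sum_cong)
    fix J assume "J \<subseteq> I"
    then have "finite J" "i \<notin> J" using insert.hyps finite_subset by auto
    then have "u + sum a (insert i J) = (u + sum a J) + a i" by (simp add: algebra_simps)
    then have "(u + sum a (insert i J)) ^ n
        = (\<Sum>k\<le>n. of_nat (n choose k) * (u + sum a J) ^ k * a i ^ (n - k))"
      by (simp only: binomial_ring)
    also have "\<dots> = (\<Sum>k<n. of_nat (n choose k) * a i ^ (n - k) * (u + sum a J) ^ k) + (u + sum a J) ^ n"
      by (simp add: lessThan_Suc_atMost[symmetric] mult_ac)
    finally show "(u + sum a (insert i J)) ^ n - (u + sum a J) ^ n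
        = (\<Sum>k<n. of_nat (n choose k) * a i ^ (n - k) * (u + sum a J) ^ k)" by simp
  qed
  also have "\<dots> = (\<Sum>k<n. of_nat (n choose k) * a i ^ (n - k) * D k)"
    by (simp add: alternating_sum_sum alternating_sum_mult_left D_def)
  also have "\<dots> = (\<Sum>k<n. if k = card I then of_nat (n choose k) * a i ^ (n - k) * (of_nat (fact k) * prod a I) else 0)"
    using insert by (intro sum.cong refl) (auto simp: D)
  \<comment> \<open>The term \<open>k = card I\<close> occurs only if \<open>n = card I + 1\<close>;
    then the binomial coefficient is \<open>n\<close>, which completes the factorial.\<close>
  also have "\<dots> = (if n = card (insert i I) then of_nat (fact n) * prod a (insert i I) else 0)"
    using insert by (auto simp: sum.delta algebra_simps)
  finally show ?case .
qed

text \<open>Write \<open>sum b J\<close> as the sum of \<open>b i\<close> times the indicator of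
  \<open>i \<in> J\<close>. Differencing in direction \<open>i\<close> compares
  \<open>g (insert i J)\<close> with 0.\<close>

lemma alternating_sum_linear_mult:
  fixes b :: "'i \<Rightarrow> 'a::comm_ring_1"
  assumes "finite I"
  shows "alternating_sum I (\<lambda>J. sum b J * g J)
    = (\<Sum>i\<in>I. b i * alternating_sum (I - {i}) (\<lambda>J. g (insert i J)))"
proof -
  have "alternating_sum I (\<lambda>J. sum b J * g J)
      = alternating_sum I (\<lambda>J. \<Sum>i\<in>I. b i * (if i \<in> J then g J else 0))"
  proof (rule alternating_sum_cong)
    fix J assume "J \<subseteq> I"
    then have "(\<Sum>i\<in>I. b i * (if i \<in> J then g J else 0)) = (\<Sum>i\<in>J. b i * g J)"
      using assms by (intro sum.mono_neutral_cong_right) auto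
    then show "sum b J * g J = (\<Sum>i\<in>I. b i * (if i \<in> J then g J else 0))"
      by (simp add: sum_distrib_right)
  qed
  also have "\<dots> = (\<Sum>i\<in>I. b i * alternating_sum I (\<lambda>J. if i \<in> J then g J else 0))"
    by (simp add: alternating_sum_sum alternating_sum_mult_left)
  also have "\<dots> = (\<Sum>i\<in>I. b i * alternating_sum (I - {i}) (\<lambda>J. g (insert i J)))"
  proof (intro sum.cong refl arg_cong2[of _ _ _ _ "(*)"])
    fix i assume "i \<in> I"
    then have "alternating_sum I (\<lambda>J. if i \<in> J then g J else 0)
        = alternating_sum (insert i (I - {i})) (\<lambda>J. if i \<in> J then g J else 0)"
      by (simp add: insert_absorb)
    also have "\<dots> = alternating_sum (I - {i}) (\<lambda>J. g (insert i J))"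
      using assms by (subst alternating_sum_insert) (auto intro!: alternating_sum_cong)
    finally show "alternating_sum I (\<lambda>J. if i \<in> J then g J else 0)
        = alternating_sum (I - {i}) (\<lambda>J. g (insert i J))" .
  qed
  finally show ?thesis .
qed

lemma alternating_sum_linear_mult_power:
  fixes a b :: "'i \<Rightarrow> 'a::comm_ring_1"
  assumes "finite I" "n < card I"
  shows "alternating_sum I (\<lambda>J. sum b J * sum a J ^ n)
    = (if Suc n = card I then of_nat (fact n) * (\<Sum>i\<in>I. b i * prod a (I - {i})) else 0)"
proof -
  have "alternating_sum I (\<lambda>J. sum b J * sum a J ^ n)
      = (\<Sum>i\<in>I. b i * alternating_sum (I - {i}) (\<lambda>J. (a i + sum a J) ^ n))"
    unfolding alternating_sum_linear_mult[OF assms(1)]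
  proof (intro sum.cong refl arg_cong2[of _ _ _ _ "(*)"] alternating_sum_cong)
    fix i J assume "J \<subseteq> I - {i}"
    then have "finite J" "i \<notin> J" using assms(1) finite_subset by auto
    then show "sum a (insert i J) ^ n = (a i + sum a J) ^ n" by simp
  qed
  also have "\<dots> = (\<Sum>i\<in>I. b i * (if Suc n = card I then of_nat (fact n) * prod a (I - {i}) else 0))"
    using assms by (intro sum.cong refl) (subst alternating_sum_power, auto simp: card_Diff_singleton)
  also have "\<dots> = (if Suc n = card I then of_nat (fact n) * (\<Sum>i\<in>I. b i * prod a (I - {i})) else 0)"
    by (simp add: sum_distrib_left mult_ac)
  finally show ?thesis .
qed

section \<open>Vectors orthogonal to the 0-1 solutions over F_p\<close>

lemma power_card_minus_one_mod_ring:
  fixes x :: "'p::prime_card mod_ring"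
  assumes "x \<noteq> 0"
  shows "x ^ (CARD('p) - 1) = 1"
proof -
  have "x ^ (CARD('p) - 1) * x = x"
    using finite_field_power_card_eq_same[of x] by (simp add: power_Suc2[symmetric] del: power_Suc)
  then show ?thesis using assms by simp
qed

lemma fact_mod_ring_nonzero:
  assumes "n < CARD('p::prime_card)"
  shows "(of_nat (fact n) :: 'p mod_ring) \<noteq> 0"
proof
  assume "(of_nat (fact n) :: 'p mod_ring) = 0"
  then have "CARD('p) dvd fact n" by (rule of_nat_0_mod_ring_dvd)
  then show False using assms prime_card[where 'a = 'p] by (simp add: prime_dvd_fact_iff)
qed

lemma orthogonal_sum_ratio_eq_0:
  fixes A b :: "'p::prime_card mod_ring ^ 'l::finite"
  assumes nz: "\<And>i. A $ i \<noteq> 0"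
    and orth: "\<And>x. x \<in> zero_one_solutions A \<Longrightarrow> (\<Sum>i\<in>UNIV. b $ i * x $ i) = 0"
    and card: "card I = CARD('p)"
  shows "(\<Sum>i\<in>I. b $ i / A $ i) = 0"
proof -
  let ?n = "CARD('p) - 1"
  have p: "CARD('p) > 1" using prime_card[where 'a = 'p] by (rule prime_gt_1_nat)
  \<comment> \<open>This says that (1 - L^(p-1)) * M vanishes on the cube, for the linear forms L of
    \<open>A\<close> and M of \<open>b\<close>: if L = 0, the point is a solution and M = 0;
    otherwise L^(p-1) = 1 by Fermat. The exponent 0 puts both sides into the shape of
    \<open>alternating_sum_linear_mult_power\<close>.\<close>
  have "sum (($) b) J * sum (($) A) J ^ 0 = sum (($) b) J * sum (($) A) J ^ ?n" for J
  proof (cases "sum (($) A) J = 0")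
    case True
    let ?x = "\<chi> i. if i \<in> J then (1 :: 'p mod_ring) else 0"
    have *: "(\<Sum>i\<in>UNIV. c $ i * ?x $ i) = sum (($) c) J" for c :: "'p mod_ring ^ 'l"
      by (rule sum.mono_neutral_cong_right) auto
    have "?x \<in> zero_one_solutions A"
      unfolding zero_one_solutions_def mem_Collect_eq * using True by simp
    then have "sum (($) b) J = 0" using orth * by metis
    then show ?thesis by simp
  next
    case False
    then show ?thesis by (simp only: power_card_minus_one_mod_ring[OF False]) simp
  qed
  then have "alternating_sum I (\<lambda>J. sum (($) b) J * sum (($) A) J ^ 0)
      = alternating_sum I (\<lambda>J. sum (($) b) J * sum (($) A) J ^ ?n)"
    by (rule alternating_sum_cong)
  \<comment> \<open>The side with exponent 0 has degree 1 < p and contributes zero.\<close>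
  then have "of_nat (fact ?n) * (\<Sum>i\<in>I. b $ i * (\<Prod>j\<in>I - {i}. A $ j)) = 0"
    using p card by (subst (asm) (1 2) alternating_sum_linear_mult_power) auto
  moreover have "of_nat (fact ?n) \<noteq> (0 :: 'p mod_ring)"
    using p by (intro fact_mod_ring_nonzero) simp
  ultimately have "(\<Sum>i\<in>I. b $ i * (\<Prod>j\<in>I - {i}. A $ j)) = 0" by simp
  also have "(\<Sum>i\<in>I. b $ i * (\<Prod>j\<in>I - {i}. A $ j)) = (\<Sum>i\<in>I. b $ i / A $ i) * (\<Prod>j\<in>I. A $ j)"
    unfolding sum_distrib_right
  proof (intro sum.cong refl)
    fix i assume "i \<in> I"
    then show "b $ i * (\<Prod>j\<in>I - {i}. A $ j) = b $ i / A $ i * (\<Prod>j\<in>I. A $ j)"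
      using nz[of i] by (subst prod.remove[of I i]) auto
  qed
  finally show ?thesis using nz by simp
qed

lemma orthogonal_imp_proportional:
  fixes A b :: "'p::prime_card mod_ring ^ 'l::finite"
  assumes large: "CARD('l) > CARD('p)"
    and nz: "\<And>i. A $ i \<noteq> 0"
    and orth: "\<And>x. x \<in> zero_one_solutions A \<Longrightarrow> (\<Sum>i\<in>UNIV. b $ i * x $ i) = 0"
  obtains c where "b = c *s A"
proof -
  let ?r = "\<lambda>i. b $ i / A $ i"
  have p: "CARD('p) > 0" by simp
  have eq: "?r i = ?r j" if "i \<noteq> j" for i j
  proof -
    \<comment> \<open>Here l > p enters: at least p - 1 indices remain besides \<open>i\<close> and
      \<open>j\<close>, and adding either one to \<open>K\<close> gives a p-set.\<close>
    have "CARD('p) - 1 \<le> card (UNIV - {i, j})"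
      using large that by (simp add: card_Diff_subset)
    then obtain K where K: "K \<subseteq> UNIV - {i, j}" "card K = CARD('p) - 1"
      by (meson obtain_subset_with_card_n)
    have "sum ?r (insert k K) = 0" if "k \<in> {i, j}" for k
      using K that p by (intro orthogonal_sum_ratio_eq_0[OF nz orth]) (auto simp: card_insert_if)
    then have "sum ?r (insert i K) = sum ?r (insert j K)" by simp
    moreover have "i \<notin> K" "j \<notin> K" using K by auto
    ultimately show ?thesis by simp
  qed
  \<comment> \<open>\<open>undefined\<close> is merely some fixed index, used to name the common
    ratio.\<close>
  have "b = ?r undefined *s A"
    unfolding vec_eq_iff
  proof
    fix i
    have "?r i = ?r undefined" using eq by (cases "i = undefined") auto
    then show "b $ i = (?r undefined *s A) $ i" using nz[of i] by (simp add: divide_eq_eq)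
  qed
  then show ?thesis by (rule that)
qed

section \<open>Orthogonality, spans and hyperplanes over a field\<close>

lemma in_vec_span_if_orthogonal:
  fixes S :: "('a::field ^ 'n::finite) set"
  assumes "\<And>b. (\<And>s. s \<in> S \<Longrightarrow> (\<Sum>i\<in>UNIV. b $ i * s $ i) = 0) \<Longrightarrow> (\<Sum>i\<in>UNIV. b $ i * x $ i) = 0"
  shows "x \<in> vec.span S"
proof (rule ccontr)
  assume x: "x \<notin> vec.span S"
  obtain B where B: "B \<subseteq> S" "vec.independent B" "S \<subseteq> vec.span B"
    by (rule vec.maximal_independent_subset)
  have xB: "x \<notin> vec.span B" using x vec.span_mono[OF B(1)] by blast
  then have "vec.independent (insert x B)" using B(2) by (simp add: vec.independent_insertI)
  \<comment> \<open>The map \<open>g\<close> fixes \<open>x\<close> and kills \<open>S\<close>. The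
    rows of its matrix are therefore orthogonal to \<open>S\<close>, hence to \<open>x\<close>,
    which forces x = g x = 0.\<close>
  from vec.linear_independent_extend[OF this, of "\<lambda>y. if y = x then x else 0"]
  obtain g where g: "Vector_Spaces.linear (*s) (*s) g" "g x = x" "\<And>y. y \<in> B \<Longrightarrow> y \<noteq> x \<Longrightarrow> g y = 0"
    by auto
  have gB: "g y = 0" if "y \<in> B" for y
    using g(3)[OF that] that xB vec.span_base by metis
  have gS: "g s = 0" if "s \<in> S" for s
    using vec.linear_eq_0_on_span[OF g(1) gB] B(3) that by blast
  have row: "g y $ k = (\<Sum>i\<in>UNIV. matrix g $ k $ i * y $ i)" for y k
    unfolding matrix_works[OF g(1), of y, symmetric] by (simp add: matrix_vector_mult_def)
  have "x $ k = 0" for k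
  proof -
    have "(\<Sum>i\<in>UNIV. matrix g $ k $ i * x $ i) = 0"
      by (rule assms) (simp add: row[symmetric] gS)
    then show ?thesis using g(2) row[of x k] by simp
  qed
  then have "x = 0" by (simp add: vec_eq_iff)
  then show False using x vec.span_zero by blast
qed

lemma dim_hyperplane_vec:
  fixes A :: "'a::field ^ 'n::finite"
  assumes "A \<noteq> 0"
  shows "vec.dim {x. (\<Sum>i\<in>UNIV. A $ i * x $ i) = 0} = CARD('n) - 1"
proof -
  let ?H = "{x. (\<Sum>i\<in>UNIV. A $ i * x $ i) = 0}"
  obtain k where k: "A $ k \<noteq> 0" using assms by (auto simp: vec_eq_iff)
  let ?e = "axis k 1 :: 'a ^ 'n"
  have e: "(\<Sum>i\<in>UNIV. A $ i * ?e $ i) = A $ k"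
    by (simp add: axis_def if_distrib cong: if_cong)
  have "vec.subspace ?H"
    by (rule vec.subspaceI)
      (auto simp: algebra_simps sum.distrib sum_distrib_left[symmetric] mult.left_commute[of _ c for c])
  then have "vec.span ?H = ?H" by (simp only: vec.span_eq_iff)
  moreover have "?e \<notin> ?H" using e k by simp
  ultimately have not_in: "?e \<notin> vec.span ?H" by (simp only: not_False_eq_True)
  have span: "y \<in> vec.span (insert ?e ?H)" for y
  proof -
    \<comment> \<open>Subtracting \<open>c *s ?e\<close> from \<open>y\<close> cancels the value of
      the form at \<open>y\<close>, so the difference lies in \<open>?H\<close>.\<close>
    define c where "c = (\<Sum>i\<in>UNIV. A $ i * y $ i) / A $ k"
    have "(\<Sum>i\<in>UNIV. A $ i * (y - c *s ?e) $ i)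
        = (\<Sum>i\<in>UNIV. A $ i * y $ i) - c * (\<Sum>i\<in>UNIV. A $ i * ?e $ i)"
      unfolding sum_distrib_left sum_subtractf[symmetric] by (simp add: algebra_simps)
    also have "\<dots> = 0" using k by (simp add: e c_def)
    finally have "y - c *s ?e \<in> ?H" by simp
    then show ?thesis unfolding vec.span_insert by (blast intro: vec.span_base)
  qed
  have "vec.span (insert ?e ?H) = UNIV" using span by blast
  then have "CARD('n) = vec.dim (vec.span (insert ?e ?H))" by (simp only: vec_dim_card)
  also have "\<dots> = vec.dim ?H + 1"
    using not_in by (simp only: vec.dim_span vec.dim_insert if_False)
  finally show ?thesis by simp
qed

theorem theorem1p1:
  fixes A :: "'p::prime_card mod_ring ^ 'l::finite"
    and p l :: nat
  assumes "p = CARD('p)"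
    and "l = CARD('l)"
    and "l > p"
    and "\<And>i. A $ i \<noteq> 0"
  shows "solution_dim A = l - 1"
proof -
  let ?H = "{x. (\<Sum>i\<in>UNIV. A $ i * x $ i) = 0}"
  have large: "CARD('l) > CARD('p)" using assms by simp
  \<comment> \<open>Whatever is orthogonal to all solutions is a multiple of \<open>A\<close>, hence
    orthogonal to \<open>?H\<close>; duality then puts \<open>?H\<close> inside the span.\<close>
  have "?H \<subseteq> vec.span (zero_one_solutions A)"
  proof
    fix x assume x: "x \<in> ?H"
    show "x \<in> vec.span (zero_one_solutions A)"
    proof (rule in_vec_span_if_orthogonal)
      fix b :: "'p mod_ring ^ 'l"
      assume "\<And>s. s \<in> zero_one_solutions A \<Longrightarrow> (\<Sum>i\<in>UNIV. b $ i * s $ i) = 0"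
      then obtain c where "b = c *s A"
        using orthogonal_imp_proportional[OF large assms(4)] by blast
      then show "(\<Sum>i\<in>UNIV. b $ i * x $ i) = 0"
        using x by (simp add: mult.assoc sum_distrib_left[symmetric])
    qed
  qed
  moreover have "zero_one_solutions A \<subseteq> ?H" by (auto simp: zero_one_solutions_def)
  ultimately have "vec.dim (zero_one_solutions A) = vec.dim ?H"
    by (intro antisym vec.dim_mono) (auto intro: vec.span_base)
  moreover have "A \<noteq> 0" using assms(4) by auto
  ultimately show ?thesis
    unfolding solution_dim_def by (simp add: dim_hyperplane_vec assms(2))
qed

end
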